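(* Consider the crowdsourcing scheduling problem and the linear program and RIS algorithm described in the context, for a parameter $\eta>0$. Let $(y,C^* )$ be the optimal solution of the linear program used by the RIS algorithm. Then, in the schedule generated by the RIS algorithm, the expected completion time of each task $s_i$ satisfies $E[C_i]\le \left(1.5+\frac{\eta}{2}\right)C_i^{*}$.
   Context: Problem: $m$ crowd workers $u_1,\dots,u_m$ with rates $\lambda_j>0$, and $n$ indivisible tasks $s_1,\dots,s_n$ with required service times $\tau_i>0$ and weights $w_i>0$. Let $e_j=\frac{2}{\lambda_j}$. Each task is assigned to one worker; each worker processes its tasks sequentially; a task $s_i$ on $u_j$ has completion time $C_i=e_j+\sum\tau_k$, summing over all tasks on $u_j$ processed no later than $s_i$ (including $s_i$). The objective is $\sum_i w_iC_i$. Intervals: for $\eta>0$ let $L=\lceil\log_{1+\eta}(\sum_{i=1}^n\tau_i)\rceil$, $\mathcal{L}=\{0,1,\dots,L\}$, $I_0=[0,1]$, $I_\ell=((1+\eta)^{\ell-1},(1+\eta)^\ell]$ for $1\le\ell\le L$, $|I_0|=1$, $|I_\ell|=\eta(1+\eta)^{\ell-1}$ for $\ell\ge1$. Linear program: minimize $\sum_i w_iC_i$ over variables $y_{ij\ell}\ge0$ ($i\in[1,n],j\in[1,m],\ell\in\mathcal{L}$) and $C_i$ subject to: $\sum_{j=1}^m\sum_{\ell=0}^L\frac{y_{ij\ell}|I_\ell|}{\tau_i}=1$ for all $i$; $\sum_{i=1}^n y_{ij\ell}\le1$ for all $j,\ell$; $C_i=D_i$ for all $i$; $C_i\ge\sum_{j=1}^m\sum_{\ell=0}^L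 y_{ij\ell}|I_\ell|$ for all $i$; where $D_i=\sum_{j=1}^m\sum_{\ell=0}^L\left(\frac{y_{ij\ell}|I_\ell|}{\tau_i}\left(e_j+(1+\eta)^{\ell-1}\right)+\frac12 y_{ij\ell}|I_\ell|\right)$, with the convention that $(1+\eta)^{\ell-1}$ is read as $\frac12$ when $\ell=0$. RIS algorithm: compute an optimal LP solution $y$; independently for each task $s_i$, choose a worker-interval pair $(j,\ell)$ with probability $\frac{y_{ij\ell}|I_\ell|}{\tau_i}$, assign $s_i$ to $u_j$ and set $t_i$ to the left endpoint of $I_\ell$; on each worker, schedule its assigned tasks as early as possible in non-decreasing order of $t_i$, breaking ties independently at random. *)

theory Defs
  imports
    "HOL-Probability.Probability"
    "HOL-Combinatorics.Multiset_Permutations"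
begin

text \<open>
  Tasks are indexed by \<open>{1..n}\<close>, workers by \<open>{1..m}\<close>; values of the parameter functions
  \<open>rate\<close> (\<open>\<lambda>\<close>), \<open>tau\<close>, \<open>w\<close> and of the LP variables outside these ranges are never used.
\<close>

definition overhead :: "(nat \<Rightarrow> real) \<Rightarrow> nat \<Rightarrow> real" where
  "overhead rate j = 2 / rate j"


subsection \<open>Geometric intervals\<close>

text \<open>
  If the total service time is at most \<open>1 / (1 + \<eta>)\<close>, the ceiling is negative;
  the index set \<open>{0, 1, \<dots>, L}\<close> is then read as \<open>{0}\<close>.
\<close>
definition last_interval :: "real \<Rightarrow> nat \<Rightarrow> (nat \<Rightarrow> real) \<Rightarrow> nat" where
  "last_interval \<eta> n tau = nat \<lceil>log (1 + \<eta>) (\<Sum>i=1..n. tau i)\<rceil>"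

definition time_interval :: "real \<Rightarrow> nat \<Rightarrow> real set" where
  "time_interval \<eta> l = (if l = 0 then {0..1} else {(1 + \<eta>) ^ (l - 1) <.. (1 + \<eta>) ^ l})"

definition interval_length :: "real \<Rightarrow> nat \<Rightarrow> real" where
  "interval_length \<eta> l = (if l = 0 then 1 else \<eta> * (1 + \<eta>) ^ (l - 1))"

definition left_endpoint :: "real \<Rightarrow> nat \<Rightarrow> real" where
  "left_endpoint \<eta> l = Inf (time_interval \<eta> l)"

lemma measure_time_interval:
  assumes "\<eta> > 0"
  shows "measure lborel (time_interval \<eta> l) = interval_length \<eta> l"
proof (cases l)
  case 0
  then show ?thesis by (simp add: time_interval_def interval_length_def)
next
  case (Suc k)
  have "(1 + \<eta>) ^ k \<le> (1 + \<eta>) ^ Suc k"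
    using assms by (intro power_increasing) auto
  then show ?thesis
    using Suc by (simp add: time_interval_def interval_length_def algebra_simps)
qed

lemma left_endpoint_0: "left_endpoint \<eta> 0 = 0"
  by (simp add: left_endpoint_def time_interval_def)

lemma left_endpoint_Suc:
  assumes "\<eta> > 0"
  shows "left_endpoint \<eta> (Suc k) = (1 + \<eta>) ^ k"
proof -
  have "(1 + \<eta>) ^ k < (1 + \<eta>) ^ Suc k"
    using assms by (intro power_strict_increasing) auto
  then show ?thesis
    by (simp add: left_endpoint_def time_interval_def)
qed


subsection \<open>The linear program\<close>

text \<open>The coefficient \<open>(1 + \<eta>) ^ (l - 1)\<close>, read as \<open>1/2\<close> for \<open>l = 0\<close>.\<close>
definition start_coeff :: "real \<Rightarrow> nat \<Rightarrow> real" where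
  "start_coeff \<eta> l = (if l = 0 then 1 / 2 else (1 + \<eta>) ^ (l - 1))"

definition lp_D ::
  "real \<Rightarrow> nat \<Rightarrow> nat \<Rightarrow> (nat \<Rightarrow> real) \<Rightarrow> (nat \<Rightarrow> real) \<Rightarrow> (nat \<Rightarrow> nat \<Rightarrow> nat \<Rightarrow> real) \<Rightarrow> nat \<Rightarrow> real"
where
  "lp_D \<eta> m n rate tau y i =
     (\<Sum>j=1..m. \<Sum>l=0..last_interval \<eta> n tau.
        y i j l * interval_length \<eta> l / tau i * (overhead rate j + start_coeff \<eta> l)
        + 1 / 2 * y i j l * interval_length \<eta> l)"

definition lp_feasible ::
  "real \<Rightarrow> nat \<Rightarrow> nat \<Rightarrow> (nat \<Rightarrow> real) \<Rightarrow> (nat \<Rightarrow> real) \<Rightarrow> (nat \<Rightarrow> nat \<Rightarrow> nat \<Rightarrow> real) \<Rightarrow> (nat \<Rightarrow> real) \<Rightarrow> bool"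
where
  "lp_feasible \<eta> m n rate tau y C \<longleftrightarrow>
     (let L = last_interval \<eta> n tau in
       (\<forall>i\<in>{1..n}. \<forall>j\<in>{1..m}. \<forall>l\<in>{0..L}. y i j l \<ge> 0) \<and>
       (\<forall>i\<in>{1..n}. (\<Sum>j=1..m. \<Sum>l=0..L. y i j l * interval_length \<eta> l / tau i) = 1) \<and>
       (\<forall>j\<in>{1..m}. \<forall>l\<in>{0..L}. (\<Sum>i=1..n. y i j l) \<le> 1) \<and>
       (\<forall>i\<in>{1..n}. C i = lp_D \<eta> m n rate tau y i) \<and>
       (\<forall>i\<in>{1..n}. C i \<ge> (\<Sum>j=1..m. \<Sum>l=0..L. y i j l * interval_length \<eta> l)))"

definition lp_optimal ::
  "real \<Rightarrow> nat \<Rightarrow> nat \<Rightarrow> (nat \<Rightarrow> real) \<Rightarrow> (nat \<Rightarrow> real) \<Rightarrow> (nat \<Rightarrow> real) \<Rightarrow>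
   (nat \<Rightarrow> nat \<Rightarrow> nat \<Rightarrow> real) \<Rightarrow> (nat \<Rightarrow> real) \<Rightarrow> bool"
where
  "lp_optimal \<eta> m n rate tau w y C \<longleftrightarrow>
     lp_feasible \<eta> m n rate tau y C \<and>
     (\<forall>y' C'. lp_feasible \<eta> m n rate tau y' C' \<longrightarrow>
        (\<Sum>i=1..n. w i * C i) \<le> (\<Sum>i=1..n. w i * C' i))"


subsection \<open>The randomized schedule\<close>

text \<open>
  The distribution of the worker-interval pair drawn for task \<open>i\<close>.  Feasibility of \<open>y\<close> makes
  \<open>embed_pmf\<close> meaningful, see \<open>pmf_ris_choice\<close> below.
\<close>
definition ris_choice ::
  "real \<Rightarrow> nat \<Rightarrow> nat \<Rightarrow> (nat \<Rightarrow> real) \<Rightarrow> (nat \<Rightarrow> nat \<Rightarrow> nat \<Rightarrow> real) \<Rightarrow> nat \<Rightarrow> (nat \<times> nat) pmf"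
where
  "ris_choice \<eta> m n tau y i = embed_pmf (\<lambda>(j, l).
     if j \<in> {1..m} \<and> l \<in> {0..last_interval \<eta> n tau}
     then y i j l * interval_length \<eta> l / tau i else 0)"

lemma pmf_ris_choice:
  assumes "\<eta> > 0" "\<And>i. i \<in> {1..n} \<Longrightarrow> tau i > 0"
    and feas: "lp_feasible \<eta> m n rate tau y C" and i: "i \<in> {1..n}"
  shows "pmf (ris_choice \<eta> m n tau y i) (j, l) =
     (if j \<in> {1..m} \<and> l \<in> {0..last_interval \<eta> n tau}
      then y i j l * interval_length \<eta> l / tau i else 0)"
proof -
  define L where "L = last_interval \<eta> n tau"
  define f where "f = (\<lambda>(j, l). if j \<in> {1..m} \<and> l \<in> {0..L}
     then y i j l * interval_length \<eta> l / tau i else 0)"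
  have len: "interval_length \<eta> l \<ge> 0" for l
    using assms(1) by (simp add: interval_length_def)
  have nonneg: "f x \<ge> 0" for x
    using feas i assms(2)[OF i] len
    by (auto simp: f_def lp_feasible_def Let_def L_def split: prod.splits)
  have supp: "f x = 0" if "x \<notin> {1..m} \<times> {0..L}" for x
    using that by (auto simp: f_def split: prod.splits)
  have "(\<integral>\<^sup>+x. ennreal (f x) \<partial>count_space UNIV)
      = (\<Sum>x\<in>{1..m} \<times> {0..L}. ennreal (f x))"
    using supp by (intro nn_integral_count_space'[of "{1..m} \<times> {0..L}"]) auto
  also have "\<dots> = ennreal (\<Sum>x\<in>{1..m} \<times> {0..L}. f x)"
    using nonneg by (simp add: sum_ennreal)
  also have "(\<Sum>x\<in>{1..m} \<times> {0..L}. f x)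
      = (\<Sum>j=1..m. \<Sum>l=0..L. f (j, l))"
    by (simp add: sum.cartesian_product)
  also have "\<dots> = (\<Sum>j=1..m. \<Sum>l=0..L. y i j l * interval_length \<eta> l / tau i)"
    by (intro sum.cong refl) (auto simp: f_def)
  also have "\<dots> = 1"
    using feas i by (simp add: lp_feasible_def Let_def L_def)
  finally have "pmf (embed_pmf f) (j, l) = f (j, l)"
    using nonneg by (intro pmf_embed_pmf) auto
  then show ?thesis
    by (simp add: ris_choice_def f_def L_def)
qed

definition ris_assignment ::
  "real \<Rightarrow> nat \<Rightarrow> nat \<Rightarrow> (nat \<Rightarrow> real) \<Rightarrow> (nat \<Rightarrow> nat \<Rightarrow> nat \<Rightarrow> real) \<Rightarrow> (nat \<Rightarrow> nat \<times> nat) pmf"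
where
  "ris_assignment \<eta> m n tau y = Pi_pmf {1..n} undefined (ris_choice \<eta> m n tau y)"

text \<open>
  All orders of a set of tasks that are non-decreasing in \<open>t\<close>.  A uniformly random element of
  this set amounts to putting each group of tasks with equal \<open>t\<close> in uniformly random
  order, independently of the other groups.
\<close>
definition sorted_orders :: "(nat \<Rightarrow> real) \<Rightarrow> nat set \<Rightarrow> nat list set" where
  "sorted_orders t A = {xs \<in> permutations_of_set A. sorted (map t xs)}"

text \<open>
  A schedule is a pair of an assignment of workers to tasks and, for each worker, the list of its
  tasks in processing order.
\<close>
definition ris_schedule ::
  "real \<Rightarrow> nat \<Rightarrow> nat \<Rightarrow> (nat \<Rightarrow> real) \<Rightarrow> (nat \<Rightarrow> nat \<Rightarrow> nat \<Rightarrow> real) \<Rightarrow>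
   ((nat \<Rightarrow> nat) \<times> (nat \<Rightarrow> nat list)) pmf"
where
  "ris_schedule \<eta> m n tau y =
     bind_pmf (ris_assignment \<eta> m n tau y) (\<lambda>a.
       let u = (\<lambda>i. fst (a i)); t = (\<lambda>i. left_endpoint \<eta> (snd (a i)))
       in map_pmf (Pair u)
            (Pi_pmf {1..m} [] (\<lambda>j. pmf_of_set (sorted_orders t {i \<in> {1..n}. u i = j}))))"

text \<open>
  Each worker starts at time \<open>overhead rate j\<close> and processes its list without idle time;
  \<open>takeWhile\<close> yields the tasks processed strictly before \<open>i\<close>.
\<close>
definition completion_time ::
  "(nat \<Rightarrow> real) \<Rightarrow> (nat \<Rightarrow> real) \<Rightarrow> (nat \<Rightarrow> nat) \<times> (nat \<Rightarrow> nat list) \<Rightarrow> nat \<Rightarrow> real"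
where
  "completion_time rate tau = (\<lambda>(u, ord) i.
     overhead rate (u i) + (\<Sum>k\<leftarrow>takeWhile (\<lambda>k. k \<noteq> i) (ord (u i)) @ [i]. tau k))"

end

theory Submission
  imports Defs
begin

text \<open>
  Fix the pair \<open>(j, l)\<close> drawn for task \<open>i\<close>.  Any other task drawing \<open>(j, l')\<close> precedes \<open>i\<close> surely
  if \<open>l' < l\<close>, with probability \<open>1/2\<close> if \<open>l' = l\<close>, and never if \<open>l' > l\<close>.  By the capacity
  constraints, the expected work in front of \<open>i\<close> is therefore at most the total length of the
  intervals before \<open>l\<close> plus half the length of interval \<open>l\<close>, that is, at most \<open>1 + \<eta> / 2\<close> times
  \<open>start_coeff \<eta> l\<close>.  Averaging over \<open>(j, l)\<close> gives
  \<open>E C\<^sub>i \<le> (1 + \<eta> / 2) * (C\<^sup>*\<^sub>i - \<tau>\<^sub>i / 2) + \<tau>\<^sub>i\<close>, and the last LP constraint says \<open>\<tau>\<^sub>i \<le> C\<^sup>*\<^sub>i\<close>.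
\<close>

section \<open>Expectations over finitely supported distributions\<close>

lemma expectation_bind_pmf_finite:
  fixes h :: "'b \<Rightarrow> real"
  assumes "finite (set_pmf p)" "\<And>x. x \<in> set_pmf p \<Longrightarrow> finite (set_pmf (f x))"
  shows "measure_pmf.expectation (bind_pmf p f) h
       = measure_pmf.expectation p (\<lambda>x. measure_pmf.expectation (f x) h)"
  using assms by (simp add: pmf_expectation_bind[of "set_pmf p"] integral_measure_pmf[of "set_pmf p"])

lemma expectation_mono_finite:
  fixes f g :: "'a \<Rightarrow> real"
  assumes "finite (set_pmf p)" "\<And>x. x \<in> set_pmf p \<Longrightarrow> f x \<le> g x"
  shows "measure_pmf.expectation p f \<le> measure_pmf.expectation p g"
  using assms by (intro integral_mono_AE integrable_measure_pmf_finite) (auto simp: AE_measure_pmf_iff)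

lemma expectation_Pi_pmf_component:
  fixes h :: "'b \<Rightarrow> real"
  assumes "finite A" "x \<in> A"
  shows "measure_pmf.expectation (Pi_pmf A d p) (\<lambda>f. h (f x)) = measure_pmf.expectation (p x) h"
proof -
  have "measure_pmf.expectation (Pi_pmf A d p) (\<lambda>f. h (f x))
      = measure_pmf.expectation (map_pmf (\<lambda>f. f x) (Pi_pmf A d p)) h"
    by simp
  then show ?thesis
    using assms by (simp add: Pi_pmf_component)
qed

text \<open>Every random choice of the algorithm has finite support; this settles all integrability
  side conditions, so completion times need no explicit bound.\<close>

lemma finite_set_Pi_pmf:
  assumes "finite A" "\<And>x. x \<in> A \<Longrightarrow> finite (set_pmf (p x))"
  shows "finite (set_pmf (Pi_pmf A d p))"
  using assms by (simp add: set_Pi_pmf finite_PiE_dflt)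


subsection \<open>Random tie breaking\<close>

lemma finite_sorted_orders: "finite (sorted_orders t A)"
  by (simp add: sorted_orders_def)

lemma sorted_orders_nonempty:
  assumes "finite A"
  shows "sorted_orders t A \<noteq> {}"
proof -
  obtain xs where xs: "set xs = A" "distinct xs"
    using finite_distinct_list[OF assms] by blast
  then have "sort_key t xs \<in> sorted_orders t A"
    by (auto simp: sorted_orders_def permutations_of_set_def)
  then show ?thesis by blast
qed

text \<open>Asymmetry of precedence. The \<open>takeWhile\<close> prefix compares first occurrences,
  so distinctness does not enter.\<close>

lemma takeWhile_not_both:
  assumes "k \<noteq> i" "k \<in> set (takeWhile (\<lambda>x. x \<noteq> i) xs)"
  shows "i \<notin> set (takeWhile (\<lambda>x. x \<noteq> k) xs)"
  using assms by (induction xs) (auto split: if_splits)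

text \<open>Relabelling by the transposition exchanges the two names and keeps all positions, which
  turns the event into its mirror image.\<close>

lemma takeWhile_map_transpose:
  "k \<in> set (takeWhile (\<lambda>x. x \<noteq> i) (map (Transposition.transpose i k) xs))
   \<longleftrightarrow> i \<in> set (takeWhile (\<lambda>x. x \<noteq> k) xs)"
proof (induction xs)
  case Nil
  then show ?case by simp
next
  case (Cons x xs)
  then show ?case
    by (auto simp: Transposition.transpose_def)
qed

text \<open>Since \<open>t\<close> agrees on \<open>i\<close> and \<open>k\<close>, it is invariant
  under the transposition, and the list of keys does not change at all.\<close>

lemma map_transpose_sorted_orders:
  assumes "xs \<in> sorted_orders t A" "i \<in> A" "k \<in> A" "t k = t i"
  shows "map (Transposition.transpose i k) xs \<in> sorted_orders t A"
proof -
  have "t \<circ> Transposition.transpose i k = t"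
    using assms by (auto simp: Transposition.transpose_def)
  moreover have "Transposition.transpose i k ` A = A"
    using assms by (simp add: transpose_image_eq)
  ultimately show ?thesis
    using assms by (auto simp: sorted_orders_def permutations_of_set_def distinct_map)
qed

text \<open>
  With equal keys, exchanging \<open>i\<close> and \<open>k\<close> injects the orders with \<open>k\<close> before \<open>i\<close> into the others.
\<close>
lemma card_precedes_tie:
  assumes "i \<in> A" "k \<in> A" "t k = t i" "k \<noteq> i"
  shows "2 * card {xs \<in> sorted_orders t A. k \<in> set (takeWhile (\<lambda>x. x \<noteq> i) xs)}
       \<le> card (sorted_orders t A)"
proof -
  let ?S = "sorted_orders t A"
  let ?B = "{xs \<in> ?S. k \<in> set (takeWhile (\<lambda>x. x \<noteq> i) xs)}"
  have fin: "finite ?S" by (rule finite_sorted_orders)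
  have "card ?B \<le> card (?S - ?B)"
  proof (rule card_inj_on_le)
    show "inj_on (map (Transposition.transpose i k)) ?B"
      by (rule inj_on_subset[of _ UNIV]) (auto intro: inj_mapI)
    show "map (Transposition.transpose i k) ` ?B \<subseteq> ?S - ?B"
    proof
      fix ys assume "ys \<in> map (Transposition.transpose i k) ` ?B"
      then obtain xs where xs: "xs \<in> ?S" "k \<in> set (takeWhile (\<lambda>x. x \<noteq> i) xs)"
        and ys: "ys = map (Transposition.transpose i k) xs"
        by auto
      have "ys \<in> ?S"
        unfolding ys using assms xs by (intro map_transpose_sorted_orders) auto
      moreover have "k \<notin> set (takeWhile (\<lambda>x. x \<noteq> i) ys)"
        unfolding ys takeWhile_map_transpose
        using assms xs by (intro takeWhile_not_both) auto
      ultimately show "ys \<in> ?S - ?B" by simp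
    qed
  qed (use fin in simp)
  moreover have "card (?S - ?B) = card ?S - card ?B"
    by (rule card_Diff_subset) (use fin in auto)
  moreover have "card ?B \<le> card ?S"
    by (rule card_mono) (use fin in auto)
  ultimately show ?thesis by linarith
qed

text \<open>An upper bound for the probability that a task with key \<open>b\<close> runs before one
  with key \<open>a\<close>, where 1/2 accounts for a random tie. The type is polymorphic because
  keys are first real start times and later interval indices.\<close>

definition precede_weight :: "'a::linorder \<Rightarrow> 'a \<Rightarrow> real" where
  "precede_weight a b = (if b < a then 1 else if b = a then 1 / 2 else 0)"

lemma precede_weight_nonneg: "precede_weight a b \<ge> 0"
  by (simp add: precede_weight_def)

text \<open>Only an upper bound is claimed: a smaller key gets the trivial bound 1, a tie gets 1/2
  from the swap of \<open>i\<close> and \<open>k\<close>, and a larger key is excluded by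
  sortedness.\<close>

lemma expectation_precedes_le:
  assumes "finite A" "i \<in> A" "k \<in> A" "k \<noteq> i"
  shows "measure_pmf.expectation (pmf_of_set (sorted_orders t A))
           (\<lambda>xs. of_bool (k \<in> set (takeWhile (\<lambda>x. x \<noteq> i) xs))) \<le> precede_weight (t i) (t k)"
proof -
  let ?S = "sorted_orders t A"
  let ?B = "{xs \<in> ?S. k \<in> set (takeWhile (\<lambda>x. x \<noteq> i) xs)}"
  have fin: "finite ?S" and ne: "?S \<noteq> {}"
    using assms finite_sorted_orders sorted_orders_nonempty by blast+
  have pos: "card ?S > 0"
    using fin ne by (simp add: card_gt_0_iff)
  have E: "measure_pmf.expectation (pmf_of_set ?S)
             (\<lambda>xs. of_bool (k \<in> set (takeWhile (\<lambda>x. x \<noteq> i) xs))) = card ?B / card ?S"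
    using fin ne by (simp add: integral_pmf_of_set of_bool_def sum.If_cases Int_def)
  consider "t k < t i" | "t k = t i" | "t k > t i" by linarith
  then show ?thesis
  proof cases
    case 1
    have "card ?B \<le> card ?S"
      by (rule card_mono) (use fin in auto)
    then show ?thesis
      using 1 pos by (simp add: E precede_weight_def)
  next
    case 2
    have "2 * card ?B \<le> card ?S"
      using assms 2 by (intro card_precedes_tie) auto
    then have "2 * real (card ?B) \<le> real (card ?S)" by linarith
    then show ?thesis
      using 2 pos by (simp add: E precede_weight_def divide_simps)
  next
    case 3
    \<comment> \<open>Otherwise \<open>i\<close> lies in the \<open>dropWhile\<close> suffix and
      \<open>k\<close> in the prefix, so sortedness across the cut forces
      \<open>t k \<le> t i\<close>.\<close>
    have "k \<notin> set (takeWhile (\<lambda>x. x \<noteq> i) xs)" if xs: "xs \<in> ?S" for xs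
    proof
      assume k: "k \<in> set (takeWhile (\<lambda>x. x \<noteq> i) xs)"
      have "i \<in> set xs"
        using xs assms by (simp add: sorted_orders_def permutations_of_set_def)
      moreover have "i \<notin> set (takeWhile (\<lambda>x. x \<noteq> i) xs)"
        using set_takeWhileD by fastforce
      ultimately have i: "i \<in> set (dropWhile (\<lambda>x. x \<noteq> i) xs)"
        by (metis Un_iff set_append takeWhile_dropWhile_id)
      have "sorted (map t (takeWhile (\<lambda>x. x \<noteq> i) xs @ dropWhile (\<lambda>x. x \<noteq> i) xs))"
        using xs by (simp add: sorted_orders_def)
      then have "t k \<le> t i"
        using k i unfolding map_append sorted_append by auto
      then show False using 3 by simp
    qed
    then have "?B = {}" by blast
    then have "card ?B = 0" by (simp only: card.empty)
    then show ?thesis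
      using 3 by (simp add: E precede_weight_def)
  qed
qed

text \<open>The work in front of \<open>i\<close> is a sum over a random prefix. Indicators turn it
  into a sum over the fixed set \<open>A - {i}\<close>, to which linearity and the pairwise bound
  apply.\<close>

lemma expectation_preceding_work_le:
  fixes tau :: "nat \<Rightarrow> real"
  assumes "finite A" "i \<in> A" "\<And>k. k \<in> A \<Longrightarrow> tau k \<ge> 0"
  shows "measure_pmf.expectation (pmf_of_set (sorted_orders t A))
           (\<lambda>xs. \<Sum>k\<leftarrow>takeWhile (\<lambda>x. x \<noteq> i) xs. tau k)
       \<le> (\<Sum>k\<in>A-{i}. tau k * precede_weight (t i) (t k))"
proof -
  let ?p = "pmf_of_set (sorted_orders t A)"
  have set: "set_pmf ?p = sorted_orders t A" and fin: "finite (set_pmf ?p)"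
    using assms finite_sorted_orders sorted_orders_nonempty by (simp_all add: set_pmf_of_set)
  have "measure_pmf.expectation ?p (\<lambda>xs. \<Sum>k\<leftarrow>takeWhile (\<lambda>x. x \<noteq> i) xs. tau k)
      = measure_pmf.expectation ?p
          (\<lambda>xs. \<Sum>k\<in>A-{i}. tau k * of_bool (k \<in> set (takeWhile (\<lambda>x. x \<noteq> i) xs)))"
  proof (rule integral_cong_AE)
    show "AE xs in ?p. (\<Sum>k\<leftarrow>takeWhile (\<lambda>x. x \<noteq> i) xs. tau k)
        = (\<Sum>k\<in>A-{i}. tau k * of_bool (k \<in> set (takeWhile (\<lambda>x. x \<noteq> i) xs)))"
      unfolding AE_measure_pmf_iff set
    proof
      fix xs assume xs: "xs \<in> sorted_orders t A"
      let ?T = "set (takeWhile (\<lambda>x. x \<noteq> i) xs)"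
      have dist: "distinct xs" and "set xs = A"
        using xs by (auto simp: sorted_orders_def permutations_of_set_def)
      then have sub: "?T \<subseteq> A - {i}"
        by (auto dest: set_takeWhileD)
      have "(\<Sum>k\<leftarrow>takeWhile (\<lambda>x. x \<noteq> i) xs. tau k) = (\<Sum>k\<in>?T. tau k)"
        using dist by (simp add: sum_list_distinct_conv_sum_set)
      also have "\<dots> = (\<Sum>k\<in>?T. tau k * of_bool (k \<in> ?T))"
        by (intro sum.cong) auto
      also have "\<dots> = (\<Sum>k\<in>A-{i}. tau k * of_bool (k \<in> ?T))"
        using assms sub by (intro sum.mono_neutral_left) auto
      finally show "(\<Sum>k\<leftarrow>takeWhile (\<lambda>x. x \<noteq> i) xs. tau k)
        = (\<Sum>k\<in>A-{i}. tau k * of_bool (k \<in> ?T))" .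
    qed
  qed auto
  also have "\<dots> = (\<Sum>k\<in>A-{i}. tau k * measure_pmf.expectation ?p
          (\<lambda>xs. of_bool (k \<in> set (takeWhile (\<lambda>x. x \<noteq> i) xs))))"
    by (simp add: integrable_measure_pmf_finite[OF fin])
  also have "\<dots> \<le> (\<Sum>k\<in>A-{i}. tau k * precede_weight (t i) (t k))"
    using assms by (intro sum_mono mult_left_mono expectation_precedes_le) auto
  finally show ?thesis .
qed


subsection \<open>Geometric intervals\<close>

text \<open>This allows start times to be replaced by interval indices: distinct intervals never
  tie, not even the first two, which start at 0 and 1.\<close>

lemma strict_mono_left_endpoint:
  assumes "\<eta> > 0"
  shows "strict_mono (left_endpoint \<eta>)"
proof (rule strict_monoI_Suc)
  fix l
  show "left_endpoint \<eta> l < left_endpoint \<eta> (Suc l)"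
    using assms by (cases l) (simp_all add: left_endpoint_0 left_endpoint_Suc)
qed

lemma precede_weight_strict_mono:
  assumes "strict_mono f"
  shows "precede_weight (f a) (f b) = precede_weight a b"
  using assms by (auto simp: precede_weight_def strict_mono_less strict_mono_eq)

text \<open>For \<open>l > 0\<close> the earlier intervals fill the time up to the left end of
  interval \<open>l\<close>, and half of interval \<open>l\<close> adds \<eta>/2 times that value,
  so equality holds. For \<open>l = 0\<close> the left side is 1/2, which is where reading the
  coefficient as 1/2 instead of 0 matters.\<close>

lemma sum_interval_length_le:
  assumes "\<eta> > 0"
  shows "(\<Sum>l'<l. interval_length \<eta> l') + interval_length \<eta> l / 2 \<le> (1 + \<eta> / 2) * start_coeff \<eta> l"
proof (cases l)
  case 0
  then show ?thesis
    using assms by (simp add: interval_length_def start_coeff_def)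
next
  case (Suc q)
  have "(\<Sum>l'<Suc q. interval_length \<eta> l') = (1 + \<eta>) ^ q" for q
    by (induction q) (simp_all add: interval_length_def algebra_simps)
  then show ?thesis
    unfolding Suc by (simp add: interval_length_def start_coeff_def algebra_simps)
qed

lemma sum_precede_weight_interval_length_le:
  assumes "\<eta> > 0" "l \<le> L"
  shows "(\<Sum>l'=0..L. precede_weight l l' * interval_length \<eta> l') \<le> (1 + \<eta> / 2) * start_coeff \<eta> l"
proof -
  have "(\<Sum>l'=0..L. precede_weight l l' * interval_length \<eta> l')
      = (\<Sum>l'\<in>insert l {..<l}. precede_weight l l' * interval_length \<eta> l')"
    using assms by (intro sum.mono_neutral_right) (auto simp: precede_weight_def)
  also have "\<dots> = (\<Sum>l'<l. interval_length \<eta> l') + interval_length \<eta> l / 2"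
    by (simp add: precede_weight_def)
  finally show ?thesis
    using sum_interval_length_le[OF assms(1)] by simp
qed


subsection \<open>The randomized schedule\<close>

text \<open>With all draws fixed, the only remaining randomness is tie breaking, and only the order
  on the worker of \<open>i\<close> affects its completion time.\<close>

lemma expectation_completion_time_given_assignment:
  fixes a :: "nat \<Rightarrow> nat \<times> nat"
  assumes "\<eta> > 0" "\<And>k. k \<in> {1..n} \<Longrightarrow> tau k \<ge> 0" "i \<in> {1..n}" "fst (a i) \<in> {1..m}"
  shows "measure_pmf.expectation
           (Pi_pmf {1..m} [] (\<lambda>j. pmf_of_set
              (sorted_orders (\<lambda>i. left_endpoint \<eta> (snd (a i))) {i \<in> {1..n}. fst (a i) = j})))
           (\<lambda>ord. completion_time rate tau (\<lambda>i. fst (a i), ord) i)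
       \<le> overhead rate (fst (a i)) + tau i
         + (\<Sum>k\<in>{1..n}-{i}. tau k
              * (of_bool (fst (a k) = fst (a i)) * precede_weight (snd (a i)) (snd (a k))))"
proof -
  define t where "t = (\<lambda>i. left_endpoint \<eta> (snd (a i)))"
  define A where "A = {k \<in> {1..n}. fst (a k) = fst (a i)}"
  define p where "p = pmf_of_set (sorted_orders t A)"
  have A: "finite A" "i \<in> A" using assms by (auto simp: A_def)
  have fin: "finite (set_pmf p)"
    unfolding p_def using A finite_sorted_orders sorted_orders_nonempty by (simp add: set_pmf_of_set)
  have "measure_pmf.expectation
          (Pi_pmf {1..m} [] (\<lambda>j. pmf_of_set (sorted_orders t {i \<in> {1..n}. fst (a i) = j})))
          (\<lambda>ord. completion_time rate tau (\<lambda>i. fst (a i), ord) i)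
      = measure_pmf.expectation p
          (\<lambda>xs. overhead rate (fst (a i)) + tau i + (\<Sum>k\<leftarrow>takeWhile (\<lambda>x. x \<noteq> i) xs. tau k))"
    unfolding p_def A_def
    \<comment> \<open>The worker of \<open>i\<close> lies in \<open>{1..m}\<close>, so its component
      is the random order and not the default \<open>[]\<close>.\<close>
    using expectation_Pi_pmf_component[of "{1..m}" "fst (a i)"
        "[]" "\<lambda>j. pmf_of_set (sorted_orders t {i \<in> {1..n}. fst (a i) = j})"
        "\<lambda>xs. overhead rate (fst (a i)) + tau i + (\<Sum>k\<leftarrow>takeWhile (\<lambda>x. x \<noteq> i) xs. tau k)"] assms(4)
    by (simp add: completion_time_def algebra_simps)
  also have "\<dots> = overhead rate (fst (a i)) + tau i
      + measure_pmf.expectation p (\<lambda>xs. \<Sum>k\<leftarrow>takeWhile (\<lambda>x. x \<noteq> i) xs. tau k)"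
    by (simp add: integrable_measure_pmf_finite[OF fin])
  also have "measure_pmf.expectation p (\<lambda>xs. \<Sum>k\<leftarrow>takeWhile (\<lambda>x. x \<noteq> i) xs. tau k)
      \<le> (\<Sum>k\<in>A-{i}. tau k * precede_weight (t i) (t k))"
    unfolding p_def using A assms by (intro expectation_preceding_work_le) (auto simp: A_def)
  also have "\<dots> = (\<Sum>k\<in>A-{i}. tau k
      * (of_bool (fst (a k) = fst (a i)) * precede_weight (snd (a i)) (snd (a k))))"
    by (intro sum.cong)
      (auto simp: A_def t_def precede_weight_strict_mono[OF strict_mono_left_endpoint[OF assms(1)]])
  \<comment> \<open>Tasks on other workers enter with coefficient 0, which makes the index set
    independent of \<open>a\<close> and prepares averaging over \<open>a\<close>.\<close>
  also have "\<dots> = (\<Sum>k\<in>{1..n}-{i}. tau k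
      * (of_bool (fst (a k) = fst (a i)) * precede_weight (snd (a i)) (snd (a k))))"
    by (intro sum.mono_neutral_left) (auto simp: A_def)
  finally show ?thesis by (simp add: t_def)
qed

section \<open>Averaging over the draws for a feasible LP solution\<close>

context
  fixes \<eta> :: real and m n :: nat and rate tau C :: "nat \<Rightarrow> real"
    and y :: "nat \<Rightarrow> nat \<Rightarrow> nat \<Rightarrow> real"
  assumes eta: "\<eta> > 0"
    and tau: "\<And>i. i \<in> {1..n} \<Longrightarrow> tau i > 0"
    and feas: "lp_feasible \<eta> m n rate tau y C"
begin

lemma interval_length_nonneg: "interval_length \<eta> l \<ge> 0"
  using eta by (simp add: interval_length_def)

lemma set_ris_choice_subset:
  assumes "i \<in> {1..n}"
  shows "set_pmf (ris_choice \<eta> m n tau y i) \<subseteq> {1..m} \<times> {0..last_interval \<eta> n tau}"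
proof
  fix x assume "x \<in> set_pmf (ris_choice \<eta> m n tau y i)"
  then show "x \<in> {1..m} \<times> {0..last_interval \<eta> n tau}"
    using pmf_ris_choice[OF eta tau feas assms, of "fst x" "snd x"]
    by (cases x) (auto simp: set_pmf_iff split: if_splits)
qed

lemma finite_set_ris_choice:
  assumes "i \<in> {1..n}"
  shows "finite (set_pmf (ris_choice \<eta> m n tau y i))"
  using set_ris_choice_subset[OF assms] by (rule finite_subset) simp

lemma expectation_ris_choice:
  fixes h :: "nat \<times> nat \<Rightarrow> real"
  assumes "i \<in> {1..n}"
  shows "measure_pmf.expectation (ris_choice \<eta> m n tau y i) h
       = (\<Sum>j=1..m. \<Sum>l=0..last_interval \<eta> n tau. y i j l * interval_length \<eta> l / tau i * h (j, l))"
proof -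
  let ?X = "{1..m} \<times> {0..last_interval \<eta> n tau}"
  have "measure_pmf.expectation (ris_choice \<eta> m n tau y i) h
      = (\<Sum>x\<in>?X. h x * pmf (ris_choice \<eta> m n tau y i) x)"
    using set_ris_choice_subset[OF assms] by (intro integral_measure_pmf_real) auto
  also have "\<dots> = (\<Sum>(j, l)\<in>?X. y i j l * interval_length \<eta> l / tau i * h (j, l))"
  proof (intro sum.cong refl, clarify)
    fix j l assume "j \<in> {1..m}" "l \<in> {0..last_interval \<eta> n tau}"
    then have "pmf (ris_choice \<eta> m n tau y i) (j, l) = y i j l * interval_length \<eta> l / tau i"
      by (subst pmf_ris_choice[OF eta tau feas assms]) auto
    then show "h (j, l) * pmf (ris_choice \<eta> m n tau y i) (j, l)
        = y i j l * interval_length \<eta> l / tau i * h (j, l)"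
      by simp
  qed
  finally show ?thesis by (simp add: sum.cartesian_product)
qed

text \<open>The service time of \<open>k\<close> cancels the denominator of its choice probability.
  What remains is the LP volume on worker \<open>j\<close>, which the capacity constraints bound
  interval by interval.\<close>

lemma expected_work_ahead_le:
  assumes j: "j \<in> {1..m}" and l: "l \<le> last_interval \<eta> n tau"
  shows "(\<Sum>k\<in>{1..n}-{i}. tau k * measure_pmf.expectation (ris_choice \<eta> m n tau y k)
            (\<lambda>q. of_bool (fst q = j) * precede_weight l (snd q)))
       \<le> (1 + \<eta> / 2) * start_coeff \<eta> l"
proof -
  define L where "L = last_interval \<eta> n tau"
  have y: "y k j l' \<ge> 0" if "k \<in> {1..n}" "l' \<in> {0..L}" for k l'
    using feas j that by (simp add: lp_feasible_def Let_def L_def)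
  have cap: "(\<Sum>k=1..n. y k j l') \<le> 1" if "l' \<in> {0..L}" for l'
    using feas j that by (simp add: lp_feasible_def Let_def L_def)
  have E: "tau k * measure_pmf.expectation (ris_choice \<eta> m n tau y k)
            (\<lambda>q. of_bool (fst q = j) * precede_weight l (snd q))
      = (\<Sum>l'=0..L. precede_weight l l' * interval_length \<eta> l' * y k j l')"
    if k: "k \<in> {1..n}" for k
  proof -
    have "measure_pmf.expectation (ris_choice \<eta> m n tau y k)
            (\<lambda>q. of_bool (fst q = j) * precede_weight l (snd q))
        = (\<Sum>j'=1..m. \<Sum>l'=0..L. y k j' l' * interval_length \<eta> l' / tau k
            * (of_bool (j' = j) * precede_weight l l'))"
      using expectation_ris_choice[OF k] by (simp add: L_def)
    also have "\<dots> = (\<Sum>j'=1..m. if j' = j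
        then \<Sum>l'=0..L. y k j l' * interval_length \<eta> l' / tau k * precede_weight l l' else 0)"
      by (intro sum.cong) auto
    also have "\<dots> = (\<Sum>l'=0..L. y k j l' * interval_length \<eta> l' / tau k * precede_weight l l')"
      using j by simp
    finally show ?thesis
      using tau[OF k] by (simp add: sum_distrib_left mult_ac)
  qed
  have "(\<Sum>k\<in>{1..n}-{i}. tau k * measure_pmf.expectation (ris_choice \<eta> m n tau y k)
            (\<lambda>q. of_bool (fst q = j) * precede_weight l (snd q)))
      = (\<Sum>k\<in>{1..n}-{i}. \<Sum>l'=0..L. precede_weight l l' * interval_length \<eta> l' * y k j l')"
    by (intro sum.cong refl E) auto
  \<comment> \<open>Adding the nonnegative term of \<open>i\<close> completes the sum that the
    capacity constraint speaks of.\<close>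
  also have "\<dots> \<le> (\<Sum>k=1..n. \<Sum>l'=0..L. precede_weight l l' * interval_length \<eta> l' * y k j l')"
    using y interval_length_nonneg precede_weight_nonneg
    by (intro sum_mono2 sum_nonneg mult_nonneg_nonneg) auto
  also have "\<dots> = (\<Sum>l'=0..L. precede_weight l l' * interval_length \<eta> l' * (\<Sum>k=1..n. y k j l'))"
    by (subst sum.swap) (simp add: sum_distrib_left)
  also have "\<dots> \<le> (\<Sum>l'=0..L. precede_weight l l' * interval_length \<eta> l' * 1)"
    using cap interval_length_nonneg precede_weight_nonneg
    by (intro sum_mono mult_left_mono mult_nonneg_nonneg) auto
  also have "\<dots> \<le> (1 + \<eta> / 2) * start_coeff \<eta> l"
    using sum_precede_weight_interval_length_le[OF eta l] by (simp add: L_def)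
  finally show ?thesis .
qed

text \<open>Exposes the draw of \<open>i\<close> first; by independence the other draws keep their
  distribution once it is fixed.\<close>

lemma ris_assignment_conv_bind:
  assumes "i \<in> {1..n}"
  shows "ris_assignment \<eta> m n tau y = bind_pmf (ris_choice \<eta> m n tau y i) (\<lambda>x.
           map_pmf (\<lambda>f. f(i := x)) (Pi_pmf ({1..n} - {i}) undefined (ris_choice \<eta> m n tau y)))"
proof -
  have "insert i ({1..n} - {i}) = {1..n}" using assms by auto
  then show ?thesis
    using Pi_pmf_insert'[of "{1..n} - {i}" i undefined "ris_choice \<eta> m n tau y"]
    by (simp add: ris_assignment_def map_pmf_def)
qed

lemma finite_set_ris_assignment: "finite (set_pmf (ris_assignment \<eta> m n tau y))"
  unfolding ris_assignment_def by (intro finite_set_Pi_pmf finite_set_ris_choice) auto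

text \<open>Expectations are taken from the inside out: over tie breaking, then over the draws of
  the other tasks, and finally over the draw of \<open>i\<close>, which stays explicit in the
  bound.\<close>

lemma expectation_completion_time_le:
  assumes i: "i \<in> {1..n}"
  shows "measure_pmf.expectation (ris_schedule \<eta> m n tau y) (\<lambda>s. completion_time rate tau s i)
       \<le> measure_pmf.expectation (ris_choice \<eta> m n tau y i)
           (\<lambda>(j, l). overhead rate j + tau i + (1 + \<eta> / 2) * start_coeff \<eta> l)"
proof -
  define q where "q = ris_choice \<eta> m n tau y"
  define B where "B = {1..n} - {i}"
  define t where "t = (\<lambda>a :: nat \<Rightarrow> nat \<times> nat. \<lambda>i. left_endpoint \<eta> (snd (a i)))"
  define ords where "ords = (\<lambda>a :: nat \<Rightarrow> nat \<times> nat.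
      Pi_pmf {1..m} [] (\<lambda>j. pmf_of_set (sorted_orders (t a) {i \<in> {1..n}. fst (a i) = j})))"
  define g where "g = (\<lambda>a :: nat \<Rightarrow> nat \<times> nat. overhead rate (fst (a i)) + tau i
      + (\<Sum>k\<in>B. tau k * (of_bool (fst (a k) = fst (a i)) * precede_weight (snd (a i)) (snd (a k)))))"
  have fin_ords: "finite (set_pmf (ords a))" for a
    unfolding ords_def
    by (intro finite_set_Pi_pmf) (auto simp: set_pmf_of_set finite_sorted_orders sorted_orders_nonempty)
  have fin_q: "finite (set_pmf (q i))"
    unfolding q_def by (rule finite_set_ris_choice[OF i])
  have fin_B: "finite (set_pmf (Pi_pmf B undefined q))"
    unfolding B_def q_def by (intro finite_set_Pi_pmf finite_set_ris_choice) auto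
  have sched: "ris_schedule \<eta> m n tau y = bind_pmf (ris_assignment \<eta> m n tau y)
      (\<lambda>a. map_pmf (Pair (\<lambda>i. fst (a i))) (ords a))"
    by (simp add: ris_schedule_def Let_def ords_def t_def)
  have "measure_pmf.expectation (ris_schedule \<eta> m n tau y) (\<lambda>s. completion_time rate tau s i)
      = measure_pmf.expectation (ris_assignment \<eta> m n tau y) (\<lambda>a. measure_pmf.expectation (ords a)
          (\<lambda>ord. completion_time rate tau (\<lambda>i. fst (a i), ord) i))"
    unfolding sched
    by (subst expectation_bind_pmf_finite) (auto simp: fin_ords finite_set_ris_assignment)
  also have "\<dots> \<le> measure_pmf.expectation (ris_assignment \<eta> m n tau y) g"
  proof (rule expectation_mono_finite[OF finite_set_ris_assignment])
    fix a assume "a \<in> set_pmf (ris_assignment \<eta> m n tau y)"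
    then have "a i \<in> set_pmf (q i)"
      using i by (auto simp: ris_assignment_def set_Pi_pmf PiE_dflt_def q_def)
    then have "fst (a i) \<in> {1..m}"
      using set_ris_choice_subset[OF i] by (auto simp: q_def)
    then show "measure_pmf.expectation (ords a)
        (\<lambda>ord. completion_time rate tau (\<lambda>i. fst (a i), ord) i) \<le> g a"
      using expectation_completion_time_given_assignment[OF eta less_imp_le[OF tau] i]
      by (simp add: ords_def t_def g_def B_def)
  qed
  also have "\<dots> = measure_pmf.expectation (q i)
      (\<lambda>x. measure_pmf.expectation (Pi_pmf B undefined q) (\<lambda>f. g (f(i := x))))"
    unfolding ris_assignment_conv_bind[OF i] B_def[symmetric] q_def[symmetric]
    by (subst expectation_bind_pmf_finite) (auto simp: fin_q fin_B)
  also have "\<dots> \<le> measure_pmf.expectation (q i)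
           (\<lambda>(j, l). overhead rate j + tau i + (1 + \<eta> / 2) * start_coeff \<eta> l)"
  proof (rule expectation_mono_finite[OF fin_q], clarify)
    fix j l assume "(j, l) \<in> set_pmf (q i)"
    then have jl: "j \<in> {1..m}" "l \<le> last_interval \<eta> n tau"
      using set_ris_choice_subset[OF i] by (auto simp: q_def)
    let ?h = "\<lambda>p :: nat \<times> nat. of_bool (fst p = j) * precede_weight l (snd p)"
    \<comment> \<open>The update touches only \<open>i\<close>, which is not in \<open>B\<close>;
      the bound becomes a sum of functions of single draws.\<close>
    have "g (f(i := (j, l))) = overhead rate j + tau i + (\<Sum>k\<in>B. tau k * ?h (f k))" for f
      unfolding g_def by (auto simp: B_def intro!: sum.cong)
    then have "measure_pmf.expectation (Pi_pmf B undefined q) (\<lambda>f. g (f(i := (j, l))))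
        = overhead rate j + tau i
          + (\<Sum>k\<in>B. tau k * measure_pmf.expectation (Pi_pmf B undefined q) (\<lambda>f. ?h (f k)))"
      by (simp add: integrable_measure_pmf_finite[OF fin_B])
    also have "(\<Sum>k\<in>B. tau k * measure_pmf.expectation (Pi_pmf B undefined q) (\<lambda>f. ?h (f k)))
        = (\<Sum>k\<in>B. tau k * measure_pmf.expectation (q k) ?h)"
    proof (rule sum.cong[OF refl])
      fix k assume "k \<in> B"
      then show "tau k * measure_pmf.expectation (Pi_pmf B undefined q) (\<lambda>f. ?h (f k))
          = tau k * measure_pmf.expectation (q k) ?h"
        using expectation_Pi_pmf_component[of B k undefined q ?h] by (simp add: B_def)
    qed
    also have "\<dots> \<le> (1 + \<eta> / 2) * start_coeff \<eta> l"
      unfolding q_def B_def by (rule expected_work_ahead_le[OF jl])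
    finally show "measure_pmf.expectation (Pi_pmf B undefined q) (\<lambda>f. g (f(i := (j, l))))
        \<le> overhead rate j + tau i + (1 + \<eta> / 2) * start_coeff \<eta> l"
      \<comment> \<open>The update stays folded so that the goal matches the accumulated
        facts.\<close>
      by (simp del: fun_upd_apply)
  qed
  finally show ?thesis by (simp add: q_def)
qed

section \<open>LP constraints in terms of the random draw\<close>

lemma sum_LP_mass:
  assumes i: "i \<in> {1..n}"
  shows "(\<Sum>j=1..m. \<Sum>l=0..last_interval \<eta> n tau. y i j l * interval_length \<eta> l) = tau i"
proof -
  have "(\<Sum>j=1..m. \<Sum>l=0..last_interval \<eta> n tau. y i j l * interval_length \<eta> l) / tau i
      = (\<Sum>j=1..m. \<Sum>l=0..last_interval \<eta> n tau. y i j l * interval_length \<eta> l / tau i)"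
    by (simp add: sum_divide_distrib)
  also have "\<dots> = 1"
    using feas i by (simp add: lp_feasible_def Let_def)
  finally show ?thesis
    using tau[OF i] by (simp add: field_simps)
qed

lemma service_time_le_C:
  assumes "i \<in> {1..n}"
  shows "tau i \<le> C i"
proof -
  have "(\<Sum>j=1..m. \<Sum>l=0..last_interval \<eta> n tau. y i j l * interval_length \<eta> l) \<le> C i"
    using feas assms unfolding lp_feasible_def Let_def by blast
  then show ?thesis
    by (simp only: sum_LP_mass[OF assms])
qed

text \<open>The coefficients of \<open>lp_D\<close> are exactly the choice probabilities, and its
  half-length terms add up to half the service time by the assignment constraint.\<close>

lemma expectation_start_eq:
  assumes i: "i \<in> {1..n}"
  shows "measure_pmf.expectation (ris_choice \<eta> m n tau y i)
           (\<lambda>(j, l). overhead rate j + start_coeff \<eta> l) = C i - tau i / 2"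
proof -
  have "C i = lp_D \<eta> m n rate tau y i"
    using feas i by (simp add: lp_feasible_def Let_def)
  also have "\<dots> = measure_pmf.expectation (ris_choice \<eta> m n tau y i)
      (\<lambda>(j, l). overhead rate j + start_coeff \<eta> l)
      + 1 / 2 * (\<Sum>j=1..m. \<Sum>l=0..last_interval \<eta> n tau. y i j l * interval_length \<eta> l)"
    unfolding lp_D_def expectation_ris_choice[OF i]
    by (simp add: sum.distrib sum_distrib_left mult.assoc)
  finally show ?thesis
    unfolding sum_LP_mass[OF i] by simp
qed

end

theorem theorem6:
  fixes \<eta> :: real and m n i :: nat
    and rate tau w :: "nat \<Rightarrow> real"
    and y :: "nat \<Rightarrow> nat \<Rightarrow> nat \<Rightarrow> real" and Cstar :: "nat \<Rightarrow> real"
  assumes "\<eta> > 0"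
    and "\<And>j. j \<in> {1..m} \<Longrightarrow> rate j > 0"
    and "\<And>i. i \<in> {1..n} \<Longrightarrow> tau i > 0"
    and "\<And>i. i \<in> {1..n} \<Longrightarrow> w i > 0"
    and "lp_optimal \<eta> m n rate tau w y Cstar"
    and "i \<in> {1..n}"
  shows "measure_pmf.expectation (ris_schedule \<eta> m n tau y) (\<lambda>s. completion_time rate tau s i)
           \<le> (1.5 + \<eta> / 2) * Cstar i"
proof -
  have feas: "lp_feasible \<eta> m n rate tau y Cstar"
    using assms(5) by (simp add: lp_optimal_def)
  note ctx = assms(1,3) feas
  let ?q = "ris_choice \<eta> m n tau y i"
  have fin: "finite (set_pmf ?q)"
    by (rule finite_set_ris_choice[OF ctx assms(6)])
  have "measure_pmf.expectation (ris_schedule \<eta> m n tau y) (\<lambda>s. completion_time rate tau s i)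
      \<le> measure_pmf.expectation ?q
           (\<lambda>(j, l). overhead rate j + tau i + (1 + \<eta> / 2) * start_coeff \<eta> l)"
    by (rule expectation_completion_time_le[OF ctx assms(6)])
  \<comment> \<open>The nonnegative overhead is inflated by the factor 1 + \<eta>/2 as well, so that
    overhead and start time form the integrand of \<open>expectation_start_eq\<close>.\<close>
  also have "\<dots> \<le> measure_pmf.expectation ?q
      (\<lambda>x. (1 + \<eta> / 2) * (case x of (j, l) \<Rightarrow> overhead rate j + start_coeff \<eta> l) + tau i)"
  proof (rule expectation_mono_finite[OF fin], clarify)
    fix j l assume "(j, l) \<in> set_pmf ?q"
    then have "rate j > 0"
      using set_ris_choice_subset[OF ctx assms(6)] assms(2) by auto
    then have "overhead rate j \<ge> 0" by (simp add: overhead_def)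
    then have "\<eta> / 2 * overhead rate j \<ge> 0" using assms(1) by simp
    then show "overhead rate j + tau i + (1 + \<eta> / 2) * start_coeff \<eta> l
        \<le> (1 + \<eta> / 2) * (overhead rate j + start_coeff \<eta> l) + tau i"
      by (simp add: algebra_simps)
  qed
  also have "\<dots> = (1 + \<eta> / 2) * (Cstar i - tau i / 2) + tau i"
    using expectation_start_eq[OF ctx assms(6)]
    by (simp add: integrable_measure_pmf_finite[OF fin])
  also have "\<dots> \<le> (1.5 + \<eta> / 2) * Cstar i"
  proof -
    \<comment> \<open>The left side equals
      \<open>(1 + \<eta> / 2) * Cstar i + tau i / 2 - \<eta> * tau i / 4\<close>. Dropping the last
      term and bounding \<open>tau i / 2\<close> by \<open>Cstar i / 2\<close> gives the constant
      1.5.\<close>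
    have "tau i \<le> Cstar i" "\<eta> * tau i \<ge> 0"
      using service_time_le_C[OF ctx assms(6)] assms(1) assms(3)[OF assms(6)] by simp_all
    then show ?thesis by (simp add: algebra_simps)
  qed
  finally show ?thesis .
qed

end
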